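(* Consider deciding predictive equivalence of decision trees over Boolean features with the QM-based procedure described in the context. 1. If the input to the set-covering step (the prime implicants and the minterms) is not required to be sorted and the set-covering step is not required to be deterministic, then the procedure can yield incorrect results: there exist two predictive equivalent decision trees $\mathcal{T}_1,\mathcal{T}_2$ and admissible runs of the procedure on them for which the procedure reports "not equivalent". 2. If the input to the set-covering step is sorted and the set-covering step is deterministic, then the procedure yields correct results: for every two decision trees $\mathcal{T}_1,\mathcal{T}_2$ on the same features and classes, it reports "equivalent" if and only if $\mathcal{T}_1$ and $\mathcal{T}_2$ are predictive equivalent.
   Context: Features are $\mathcal{F}=\{1,\dots,m\}$ with Boolean domains; feature space is $\mathbb{F}=\{0,1\}^m$; $\mathbb{K}$ is a finite set of classes. A decision tree (DT) $\mathcal{T}$ is a finite rooted tree in which each non-terminal node is labelled with a feature $i$ and has two children, one for $x_i=0$ and one for $x_i=1$, and each terminal node is labelled with a class in $\mathbb{K}$. The literals on every root-to-terminal path are consistent, and each $\mathbf{x}\in\mathbb{F}$ is consistent with exactly one such path. $\mathcal{T}$ computes $\kappa_{\mathcal{T}}:\mathbb{F}\to\mathbb{K}$, sending $\mathbf{x}$ to the class at the end of that path. Two DTs $\mathcal{T}_1,\mathcal{T}_2$ are predictive equivalent if $\kappa_{\mathcal{T}_1}(\mathbf{x})=\kappa_{\mathcal{T}_2}(\mathbf{x})$ for all $\mathbf{x}\in\mathbb{F}$. For a class $c$ let $\pi_c(\mathbf{x})=[\kappa_{\mathcal{T}}(\mathbf{x})=c]$. A term is a consistent conjunction of literals ($x_i$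 or $\neg x_i$). An implicant of $\pi_c$ is a term that entails $\pi_c$. A prime implicant is an implicant for which dropping any literal yields a non-implicant. A minterm of $\pi_c$ is an implicant consistent with exactly one point of $\mathbb{F}$. The Quine-McCluskey (QM) method, applied to $\mathcal{T}$ and $c$, (a) computes the set of all prime implicants and the set of all minterms of $\pi_c$, each listed in some order; (b) (set-covering step) takes these two lists as input and outputs a minimum-cost set of prime implicants such that every minterm entails at least one selected prime implicant, where cost is a fixed measure such as the number of terms or the number of literals. The output, viewed as a disjunction of terms (compared as a set of terms), is denoted $\mathcal{T}_{\mathsf{DNF},c}$. In an admissible run, any minimum-cost cover may be output by step (b). The input to the set-covering step is sorted if both lists are arranged according to a fixed total order on terms. The set-covering step is deterministic if its output is a function of its input lists, i.e. the same input lists always give the same output. The QM-based procedure for predictive equivalence runs the QM method on $\mathcal{T}_1$ and $\mathcal{T}_2$ for each $c\in\mathbb{K}$, and reports "equivalent" if and only if $\mathcal{T}_{1,\mathsf{DNF},c}=\mathcal{T}_{2,\mathsf{DNF},c}$ for all $c\in\mathbb{K}$. *)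

theory Defs
  imports Main "HOL-Library.FuncSet"
begin

definition feature_space :: "nat \<Rightarrow> (nat \<Rightarrow> bool) set" where
  "feature_space m = {1..m} \<rightarrow>\<^sub>E (UNIV :: bool set)"

text \<open>The literal \<open>(i, True)\<close> is \<open>x\<^sub>i\<close> and \<open>(i, False)\<close> is \<open>\<not> x\<^sub>i\<close>; a conjunction of literals
  is the set of its conjuncts.\<close>

type_synonym lit = "nat \<times> bool"
type_synonym conj_term = "lit set"

definition terms :: "nat \<Rightarrow> conj_term set" where
  "terms m = {t. fst ` t \<subseteq> {1..m} \<and> (\<forall>i. \<not> ((i, True) \<in> t \<and> (i, False) \<in> t))}"

definition satisfies :: "(nat \<Rightarrow> bool) \<Rightarrow> conj_term \<Rightarrow> bool" where
  "satisfies x t \<longleftrightarrow> (\<forall>(i, b)\<in>t. x i = b)"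

text \<open>In \<open>Node i T0 T1\<close>, \<open>T0\<close> is the child for \<open>x\<^sub>i = 0\<close> and \<open>T1\<close> the child for \<open>x\<^sub>i = 1\<close>.\<close>

datatype 'k dtree = Terminal 'k | Node nat "'k dtree" "'k dtree"

text \<open>A root-to-terminal path is the list of its literals paired with the class at its end.\<close>

fun paths :: "'k dtree \<Rightarrow> (lit list \<times> 'k) set" where
  "paths (Terminal k) = {([], k)}"
| "paths (Node i T0 T1) =
     (\<lambda>(p, k). ((i, False) # p, k)) ` paths T0 \<union> (\<lambda>(p, k). ((i, True) # p, k)) ` paths T1"

definition decision_trees :: "nat \<Rightarrow> 'k set \<Rightarrow> 'k dtree set" where
  "decision_trees m K = {T. \<forall>(p, k)\<in>paths T. set p \<in> terms m \<and> k \<in> K}"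

lemma ex1_path: "\<exists>!q. q \<in> paths T \<and> satisfies x (set (fst q))"
proof (induction T)
  case (Terminal k)
  show ?case by (auto simp: satisfies_def)
next
  case (Node i T0 T1)
  have *: "satisfies x (insert (i, b) t) \<longleftrightarrow> x i = b \<and> satisfies x t" for b t
    by (auto simp: satisfies_def)
  show ?case
  proof (cases "x i")
    case True
    obtain q where q: "q \<in> paths T1" "satisfies x (set (fst q))"
      and u: "\<And>q'. q' \<in> paths T1 \<Longrightarrow> satisfies x (set (fst q')) \<Longrightarrow> q' = q"
      using Node.IH(2) by blast
    show ?thesis
    proof (rule ex1I[of _ "((i, True) # fst q, snd q)"])
      show "((i, True) # fst q, snd q) \<in> paths (Node i T0 T1) \<and>
            satisfies x (set (fst ((i, True) # fst q, snd q)))"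
        using q True by (cases q) (auto simp: * intro: rev_image_eqI)
    qed (use True u in \<open>fastforce simp: *\<close>)
  next
    case False
    obtain q where q: "q \<in> paths T0" "satisfies x (set (fst q))"
      and u: "\<And>q'. q' \<in> paths T0 \<Longrightarrow> satisfies x (set (fst q')) \<Longrightarrow> q' = q"
      using Node.IH(1) by blast
    show ?thesis
    proof (rule ex1I[of _ "((i, False) # fst q, snd q)"])
      show "((i, False) # fst q, snd q) \<in> paths (Node i T0 T1) \<and>
            satisfies x (set (fst ((i, False) # fst q, snd q)))"
        using q False by (cases q) (auto simp: * intro: rev_image_eqI)
    qed (use False u in \<open>fastforce simp: *\<close>)
  qed
qed

text \<open>By \<open>ex1_path\<close> the description below is proper.\<close>

definition kappa :: "'k dtree \<Rightarrow> (nat \<Rightarrow> bool) \<Rightarrow> 'k" where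
  "kappa T x = (THE k. \<exists>p. (p, k) \<in> paths T \<and> satisfies x (set p))"

definition predictive_equivalent :: "nat \<Rightarrow> 'k dtree \<Rightarrow> 'k dtree \<Rightarrow> bool" where
  "predictive_equivalent m T1 T2 \<longleftrightarrow> (\<forall>x\<in>feature_space m. kappa T1 x = kappa T2 x)"

definition class_pred :: "'k dtree \<Rightarrow> 'k \<Rightarrow> (nat \<Rightarrow> bool) \<Rightarrow> bool" where
  "class_pred T c x \<longleftrightarrow> kappa T x = c"

definition implicant :: "nat \<Rightarrow> ((nat \<Rightarrow> bool) \<Rightarrow> bool) \<Rightarrow> conj_term \<Rightarrow> bool" where
  "implicant m f t \<longleftrightarrow> t \<in> terms m \<and> (\<forall>x\<in>feature_space m. satisfies x t \<longrightarrow> f x)"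

definition prime_implicant :: "nat \<Rightarrow> ((nat \<Rightarrow> bool) \<Rightarrow> bool) \<Rightarrow> conj_term \<Rightarrow> bool" where
  "prime_implicant m f t \<longleftrightarrow> implicant m f t \<and> (\<forall>l\<in>t. \<not> implicant m f (t - {l}))"

definition minterm :: "nat \<Rightarrow> ((nat \<Rightarrow> bool) \<Rightarrow> bool) \<Rightarrow> conj_term \<Rightarrow> bool" where
  "minterm m f t \<longleftrightarrow> implicant m f t \<and> (\<exists>!x. x \<in> feature_space m \<and> satisfies x t)"

definition term_entails :: "nat \<Rightarrow> conj_term \<Rightarrow> conj_term \<Rightarrow> bool" where
  "term_entails m s t \<longleftrightarrow> (\<forall>x\<in>feature_space m. satisfies x s \<longrightarrow> satisfies x t)"

definition listing_of :: "'a set \<Rightarrow> 'a list \<Rightarrow> bool" where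
  "listing_of A xs \<longleftrightarrow> set xs = A \<and> distinct xs"

definition cover :: "nat \<Rightarrow> conj_term list \<Rightarrow> conj_term list \<Rightarrow> conj_term set \<Rightarrow> bool" where
  "cover m ps ms S \<longleftrightarrow> S \<subseteq> set ps \<and> (\<forall>t\<in>set ms. \<exists>p\<in>S. term_entails m t p)"

definition min_cover ::
  "nat \<Rightarrow> (conj_term set \<Rightarrow> 'c::linorder) \<Rightarrow> conj_term list \<Rightarrow> conj_term list \<Rightarrow> conj_term set \<Rightarrow> bool"
  where "min_cover m cost ps ms = is_arg_min cost (cover m ps ms)"

definition num_terms :: "conj_term set \<Rightarrow> nat" where
  "num_terms S = card S"

definition num_literals :: "conj_term set \<Rightarrow> nat" where
  "num_literals S = (\<Sum>t\<in>S. card t)"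

text \<open>A set-covering step is a relation between the two input lists and the possible outputs.
  Every output is a minimum-cost cover, and there is an output whenever the input has a cover.
  The step \<open>min_cover m cost\<close> is the one that may output any minimum-cost cover.\<close>

type_synonym step = "conj_term list \<Rightarrow> conj_term list \<Rightarrow> conj_term set \<Rightarrow> bool"

definition set_covering_step :: "nat \<Rightarrow> (conj_term set \<Rightarrow> 'c::linorder) \<Rightarrow> step \<Rightarrow> bool" where
  "set_covering_step m cost step \<longleftrightarrow>
     (\<forall>ps ms S. step ps ms S \<longrightarrow> min_cover m cost ps ms S) \<and>
     (\<forall>ps ms. (\<exists>S. cover m ps ms S) \<longrightarrow> (\<exists>S. step ps ms S))"

definition deterministic :: "step \<Rightarrow> bool" where
  "deterministic step \<longleftrightarrow> (\<forall>ps ms S S'. step ps ms S \<longrightarrow> step ps ms S' \<longrightarrow> S = S')"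

definition inputs :: "nat \<Rightarrow> 'k dtree \<Rightarrow> 'k \<Rightarrow> (conj_term list \<times> conj_term list) set" where
  "inputs m T c = {(ps, ms). listing_of {t. prime_implicant m (class_pred T c) t} ps \<and>
                             listing_of {t. minterm m (class_pred T c) t} ms}"

definition sorted_inputs ::
  "nat \<Rightarrow> conj_term rel \<Rightarrow> 'k dtree \<Rightarrow> 'k \<Rightarrow> (conj_term list \<times> conj_term list) set" where
  "sorted_inputs m r T c = {(ps, ms) \<in> inputs m T c.
     sorted_wrt (\<lambda>s t. (s, t) \<in> r) ps \<and> sorted_wrt (\<lambda>s t. (s, t) \<in> r) ms}"

definition qm_outputs ::
  "('k dtree \<Rightarrow> 'k \<Rightarrow> (conj_term list \<times> conj_term list) set) \<Rightarrow> step \<Rightarrow> 'k dtree \<Rightarrow> 'k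
     \<Rightarrow> conj_term set set" where
  "qm_outputs inp step T c = {S. \<exists>(ps, ms)\<in>inp T c. step ps ms S}"

text \<open>\<open>may_report K inp step T1 T2 b\<close>: some run of the procedure, with inputs to the set-covering step
  drawn from \<open>inp\<close>, reports ``equivalent'' (\<open>b = True\<close>) or ``not equivalent'' (\<open>b = False\<close>).
  \<open>D1\<close> and \<open>D2\<close> are the DNFs produced in that run.\<close>

definition may_report ::
  "'k set \<Rightarrow> ('k dtree \<Rightarrow> 'k \<Rightarrow> (conj_term list \<times> conj_term list) set) \<Rightarrow> step
     \<Rightarrow> 'k dtree \<Rightarrow> 'k dtree \<Rightarrow> bool \<Rightarrow> bool" where
  "may_report K inp step T1 T2 b \<longleftrightarrow>
     (\<exists>D1 D2. (\<forall>c\<in>K. D1 c \<in> qm_outputs inp step T1 c \<and> D2 c \<in> qm_outputs inp step T2 c) \<and>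
              (b \<longleftrightarrow> (\<forall>c\<in>K. D1 c = D2 c)))"

end

theory Submission
  imports Defs
begin

text \<open>A sorted duplicate-free listing of a finite set is unique, so with sorted input and a
  deterministic step the DNF of a class depends only on the predicate of that class. Conversely
  the DNF determines the predicate, since a point of the class satisfies a selected
  prime implicant through its minterm. The counterexample for unsorted, nondeterministic runs
  is ``not all of \<open>x\<^sub>1, x\<^sub>2, x\<^sub>3\<close> are equal'', whose prime implicants \<open>x\<^sub>i \<and> \<not> x\<^sub>j\<close> contain two disjoint
  minimum-cost covers, one for each orientation of the cycle \<open>1, 2, 3\<close>.\<close>

section \<open>Evaluating decision trees\<close>

lemma kappa_eqI:
  assumes "(p, k) \<in> paths T" "satisfies x (set p)"
  shows "kappa T x = k"
  unfolding kappa_def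
proof (rule the_equality)
  show "\<exists>p. (p, k) \<in> paths T \<and> satisfies x (set p)"
    using assms by blast
next
  fix k' assume "\<exists>p. (p, k') \<in> paths T \<and> satisfies x (set p)"
  then obtain p' where "(p', k') \<in> paths T" "satisfies x (set p')" by blast
  then have "(p', k') = (p, k)"
    using assms ex1_path[of T x] by (metis fst_conv)
  then show "k' = k" by simp
qed

lemma kappa_path: "\<exists>p. (p, kappa T x) \<in> paths T \<and> satisfies x (set p)"
proof -
  obtain p k where "(p, k) \<in> paths T" "satisfies x (set p)"
    using ex1_path[of T x] by (metis prod.collapse)
  then show ?thesis using kappa_eqI by metis
qed

lemma kappa_Terminal [simp]: "kappa (Terminal k) x = k"
  by (rule kappa_eqI[of "[]"]) (auto simp: satisfies_def)

text \<open>Prepending the tested literal extends the path of \<open>x\<close> in the chosen child.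
  With this recursion the simplifier can evaluate concrete trees.\<close>

lemma kappa_Node [simp]:
  "kappa (Node i T0 T1) x = (if x i then kappa T1 x else kappa T0 x)"
proof (cases "x i")
  case True
  obtain p where "(p, kappa T1 x) \<in> paths T1" "satisfies x (set p)"
    using kappa_path by blast
  then have "kappa (Node i T0 T1) x = kappa T1 x"
    using True by (intro kappa_eqI[of "(i, True) # p"]) (force simp: satisfies_def)+
  with True show ?thesis by simp
next
  case False
  obtain p where "(p, kappa T0 x) \<in> paths T0" "satisfies x (set p)"
    using kappa_path by blast
  then have "kappa (Node i T0 T1) x = kappa T0 x"
    using False by (intro kappa_eqI[of "(i, False) # p"]) (force simp: satisfies_def)+
  with False show ?thesis by simp
qed

lemma kappa_in_classes: "T \<in> decision_trees m K \<Longrightarrow> kappa T x \<in> K"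
  using kappa_path[of T x] unfolding decision_trees_def by fastforce

section \<open>Terms, prime implicants and minterms\<close>

lemma finite_terms: "finite (terms m)"
proof (rule finite_subset)
  show "terms m \<subseteq> Pow ({1..m} \<times> UNIV)"
    by (auto simp: terms_def)
qed simp

lemma finite_term: "t \<in> terms m \<Longrightarrow> finite t"
  by (rule finite_subset[of _ "{1..m} \<times> UNIV"]) (auto simp: terms_def)

lemma satisfies_mono: "satisfies x t \<Longrightarrow> p \<subseteq> t \<Longrightarrow> satisfies x p"
  by (auto simp: satisfies_def)

lemma prime_implicant_below:
  assumes "implicant m f t"
  shows "\<exists>p\<subseteq>t. prime_implicant m f p"
proof -
  have "finite t" using assms finite_term by (auto simp: implicant_def)
  then show ?thesis using assms
  proof (induction t rule: finite_psubset_induct)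
    case (psubset t)
    show ?case
    proof (cases "prime_implicant m f t")
      case False
      then obtain l where "l \<in> t" "implicant m f (t - {l})"
        using psubset.prems by (auto simp: prime_implicant_def)
      then show ?thesis using psubset.IH[of "t - {l}"] by blast
    qed auto
  qed
qed

definition point_term :: "nat \<Rightarrow> (nat \<Rightarrow> bool) \<Rightarrow> conj_term" where
  "point_term m x = (\<lambda>i. (i, x i)) ` {1..m}"

text \<open>Points are extensional functions, so agreement on \<open>{1..m}\<close> already forces
  equality.\<close>

lemma satisfies_point_term:
  assumes "x \<in> feature_space m" "y \<in> feature_space m"
  shows "satisfies y (point_term m x) \<longleftrightarrow> y = x"
  using assms unfolding feature_space_def satisfies_def point_term_def
  by (auto intro!: PiE_ext)

lemma minterm_point_term:
  assumes "x \<in> feature_space m" "f x"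
  shows "minterm m f (point_term m x)"
proof -
  have "point_term m x \<in> terms m"
    by (auto simp: point_term_def terms_def)
  then show ?thesis
    using assms by (auto simp: minterm_def implicant_def satisfies_point_term)
qed

text \<open>Guarantees that the set-covering step has an output: every minterm contains a prime
  implicant, and a term entails each of its subsets.\<close>

lemma cover_prime_implicants:
  assumes "set ps = {t. prime_implicant m f t}" "set ms = {t. minterm m f t}"
  shows "cover m ps ms (set ps)"
proof -
  have "\<exists>p. prime_implicant m f p \<and> term_entails m t p" if "minterm m f t" for t
  proof -
    have "implicant m f t" using that by (simp add: minterm_def)
    then obtain p where "p \<subseteq> t" "prime_implicant m f p"
      using prime_implicant_below by blast
    then show ?thesis using satisfies_mono unfolding term_entails_def by blast
  qed
  then show ?thesis using assms by (auto simp: cover_def)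
qed

lemma finite_Collect_terms:
  assumes "\<And>t. P t \<Longrightarrow> t \<in> terms m"
  shows "finite {t. P t}"
  by (rule finite_subset[OF _ finite_terms[of m]]) (use assms in auto)

lemma finite_prime_implicants: "finite {t. prime_implicant m f t}"
  by (rule finite_Collect_terms[of _ m]) (simp add: prime_implicant_def implicant_def)

lemma finite_minterms: "finite {t. minterm m f t}"
  by (rule finite_Collect_terms[of _ m]) (simp add: minterm_def implicant_def)

section \<open>Minimum covers and sorted listings\<close>

lemma ex_min_cover:
  fixes cost :: "conj_term set \<Rightarrow> 'c::linorder"
  assumes "cover m ps ms S"
  shows "\<exists>S. min_cover m cost ps ms S"
proof -
  have "finite {S. cover m ps ms S}"
    by (rule finite_subset[of _ "Pow (set ps)"]) (auto simp: cover_def)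
  then show ?thesis
    using ex_is_arg_min_if_finite[of "{S. cover m ps ms S}" cost] assms
    by (auto simp: min_cover_def)
qed

lemma ex_listing: "finite A \<Longrightarrow> \<exists>xs. listing_of A xs"
  using finite_distinct_list[of A] by (auto simp: listing_of_def)

text \<open>Selection sort: put an \<open>r\<close>-least element first and list the rest by
  induction.\<close>

lemma ex_sorted_listing:
  assumes "linear_order_on B r" "finite A" "A \<subseteq> B"
  shows "\<exists>xs. listing_of A xs \<and> sorted_wrt (\<lambda>s t. (s, t) \<in> r) xs"
  using assms(2,3)
proof (induction A rule: finite_psubset_induct)
  case (psubset A)
  have r: "\<And>x. x \<in> B \<Longrightarrow> (x, x) \<in> r" "trans r"
    "\<And>x y. x \<in> B \<Longrightarrow> y \<in> B \<Longrightarrow> x \<noteq> y \<Longrightarrow> (x, y) \<in> r \<or> (y, x) \<in> r"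
    using assms(1)
    by (auto simp: order_on_defs refl_on_def total_on_def)
  show ?case
  proof (cases "A = {}")
    case False
    \<comment> \<open>Inductively, either the least element of \<open>F\<close> stays least or, by
      totality and transitivity, the new element \<open>x\<close> takes its place.\<close>
    have "\<exists>a\<in>A. \<forall>b\<in>A. (a, b) \<in> r"
      using psubset.hyps False psubset.prems
    proof (induction A rule: finite_ne_induct)
      case (singleton x)
      then show ?case using r(1) by auto
    next
      case (insert x F)
      then obtain a where a: "a \<in> F" "\<forall>b\<in>F. (a, b) \<in> r" by auto
      show ?case
      proof (cases "(a, x) \<in> r")
        case False
        then have "(x, a) \<in> r" using r(3)[of a x] r(1) a insert.prems by auto
        then have "\<forall>b\<in>F. (x, b) \<in> r" using a(2) r(2) by (meson transD)
        then show ?thesis using r(1) insert.prems by auto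
      qed (use a in auto)
    qed
    then obtain a where a: "a \<in> A" "\<forall>b\<in>A. (a, b) \<in> r" by blast
    have "\<exists>xs. listing_of (A - {a}) xs \<and> sorted_wrt (\<lambda>s t. (s, t) \<in> r) xs"
      using a(1) psubset.prems by (intro psubset.IH) auto
    then obtain xs where "listing_of (A - {a}) xs" "sorted_wrt (\<lambda>s t. (s, t) \<in> r) xs"
      by blast
    then show ?thesis
      using a by (intro exI[of _ "a # xs"]) (auto simp: listing_of_def)
  qed (auto simp: listing_of_def)
qed

text \<open>If the heads differed, each would occur in the tail of the other list, so
  \<open>r\<close> would relate them both ways, against antisymmetry.\<close>

lemma sorted_listing_unique:
  assumes "antisym r" "listing_of A xs" "listing_of A ys"
    "sorted_wrt (\<lambda>s t. (s, t) \<in> r) xs" "sorted_wrt (\<lambda>s t. (s, t) \<in> r) ys"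
  shows "xs = ys"
  using assms(2-5)
proof (induction xs arbitrary: A ys)
  case Nil
  then show ?case by (auto simp: listing_of_def)
next
  case (Cons x xs)
  then obtain y ys' where ys: "ys = y # ys'"
    by (cases ys) (auto simp: listing_of_def)
  have A: "insert x (set xs) = A" "insert y (set ys') = A"
    using Cons.prems ys by (auto simp: listing_of_def)
  have "x = y"
  proof (rule ccontr)
    assume "x \<noteq> y"
    then have "y \<in> set xs" "x \<in> set ys'" using A by auto
    then have "(x, y) \<in> r" "(y, x) \<in> r" using Cons.prems ys by auto
    with \<open>x \<noteq> y\<close> assms(1) show False by (auto dest: antisymD)
  qed
  moreover have "xs = ys'"
    by (rule Cons.IH[of "A - {x}"])
      (use Cons.prems ys \<open>x = y\<close> in \<open>auto simp: listing_of_def\<close>)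
  ultimately show ?case using ys by simp
qed

section \<open>Sorted, deterministic runs\<close>

lemma sorted_inputs_ex1:
  assumes "linear_order_on (terms m) r"
  shows "\<exists>!q. q \<in> sorted_inputs m r T c"
proof -
  let ?s = "sorted_wrt (\<lambda>s t. (s, t) \<in> r)"
  have sub: "{t. prime_implicant m (class_pred T c) t} \<subseteq> terms m"
    "{t. minterm m (class_pred T c) t} \<subseteq> terms m"
    by (auto simp: prime_implicant_def minterm_def implicant_def)
  obtain ps where ps: "listing_of {t. prime_implicant m (class_pred T c) t} ps" "?s ps"
    using ex_sorted_listing[OF assms finite_prime_implicants sub(1)] by blast
  obtain ms where ms: "listing_of {t. minterm m (class_pred T c) t} ms" "?s ms"
    using ex_sorted_listing[OF assms finite_minterms sub(2)] by blast
  have "antisym r" using assms by (auto simp: order_on_defs)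
  show ?thesis
  proof (rule ex1I[of _ "(ps, ms)"])
    show "(ps, ms) \<in> sorted_inputs m r T c"
      using ps ms by (auto simp: sorted_inputs_def inputs_def)
    show "q = (ps, ms)" if "q \<in> sorted_inputs m r T c" for q
      using that ps ms sorted_listing_unique[OF \<open>antisym r\<close>]
      by (auto simp: sorted_inputs_def inputs_def)
  qed
qed

text \<open>The sorted input is unique and has a cover. The step therefore has an output on it, and
  determinism allows no second one.\<close>

lemma qm_outputs_sorted_ex1:
  assumes "linear_order_on (terms m) r" "set_covering_step m cost step" "deterministic step"
  shows "\<exists>!S. S \<in> qm_outputs (sorted_inputs m r) step T c"
proof -
  obtain ps ms where q: "(ps, ms) \<in> sorted_inputs m r T c"
    and u: "\<And>q. q \<in> sorted_inputs m r T c \<Longrightarrow> q = (ps, ms)"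
    using sorted_inputs_ex1[OF assms(1), of T c] by (metis surj_pair)
  have "cover m ps ms (set ps)"
    using q by (intro cover_prime_implicants[of _ _ "class_pred T c"])
      (auto simp: sorted_inputs_def inputs_def listing_of_def)
  then obtain S where "step ps ms S"
    using assms(2) unfolding set_covering_step_def by blast
  moreover have "S' \<in> qm_outputs (sorted_inputs m r) step T c \<longleftrightarrow> step ps ms S'" for S'
    using q u by (auto simp: qm_outputs_def)
  ultimately show ?thesis
    using assms(3) unfolding deterministic_def by blast
qed

text \<open>The DNF represents its class whichever minimum-cost cover is returned: the minterm of
  \<open>x\<close> supplies a selected term, and selected terms are implicants.\<close>

lemma qm_outputs_sound:
  assumes "set_covering_step m cost step" "S \<in> qm_outputs (sorted_inputs m r) step T c"
    "x \<in> feature_space m"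
  shows "kappa T x = c \<longleftrightarrow> (\<exists>p\<in>S. satisfies x p)"
proof -
  obtain ps ms where q: "set ps = {t. prime_implicant m (class_pred T c) t}"
    "set ms = {t. minterm m (class_pred T c) t}" and "step ps ms S"
    using assms(2) by (auto simp: qm_outputs_def sorted_inputs_def inputs_def listing_of_def)
  then have "cover m ps ms S"
    using assms(1) by (auto simp: set_covering_step_def min_cover_def is_arg_min_def)
  then have S: "\<And>p. p \<in> S \<Longrightarrow> prime_implicant m (class_pred T c) p"
    "\<And>t. minterm m (class_pred T c) t \<Longrightarrow> \<exists>p\<in>S. term_entails m t p"
    using q by (auto simp: cover_def)
  show ?thesis
  proof
    assume "kappa T x = c"
    then have "minterm m (class_pred T c) (point_term m x)"
      using assms(3) by (intro minterm_point_term) (auto simp: class_pred_def)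
    then show "\<exists>p\<in>S. satisfies x p"
      using S(2) assms(3) satisfies_point_term[of x m x] by (auto simp: term_entails_def)
  next
    assume "\<exists>p\<in>S. satisfies x p"
    then show "kappa T x = c"
      using S(1) assms(3) by (auto simp: prime_implicant_def implicant_def class_pred_def)
  qed
qed

lemma sorted_inputs_cong:
  assumes "predictive_equivalent m T1 T2"
  shows "sorted_inputs m r T1 c = sorted_inputs m r T2 c"
proof -
  \<comment> \<open>The two predicates are only known to agree on \<open>feature_space m\<close>,
    but \<open>implicant\<close> inspects them nowhere else.\<close>
  have *: "implicant m (class_pred T1 c) = implicant m (class_pred T2 c)"
    using assms by (auto simp: implicant_def predictive_equivalent_def class_pred_def fun_eq_iff)
  show ?thesis
    by (simp add: sorted_inputs_def inputs_def prime_implicant_def minterm_def *)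
qed

text \<open>Quantified over \<open>b\<close>, this says two things: every run gives the right answer
  (\<open>eq\<close>), and some run exists (the choice of \<open>D1\<close> and
  \<open>D2\<close>).\<close>

lemma may_report_sorted_iff:
  assumes r: "linear_order_on (terms m) r"
    and step: "set_covering_step m cost step" and det: "deterministic step"
    and T1: "(T1 :: 'a dtree) \<in> decision_trees m K"
  shows "may_report K (sorted_inputs m r) step T1 T2 b \<longleftrightarrow> b = predictive_equivalent m T1 T2"
proof -
  let ?Q = "qm_outputs (sorted_inputs m r) step"
  have eq: "(\<forall>c\<in>K. D1 c = D2 c) \<longleftrightarrow> predictive_equivalent m T1 T2"
    if D: "\<And>c. c \<in> K \<Longrightarrow> D1 c \<in> ?Q T1 c" "\<And>c. c \<in> K \<Longrightarrow> D2 c \<in> ?Q T2 c" for D1 D2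
  proof
    assume same: "\<forall>c\<in>K. D1 c = D2 c"
    show "predictive_equivalent m T1 T2"
      unfolding predictive_equivalent_def
    proof
      fix x assume x: "x \<in> feature_space m"
      \<comment> \<open>This class lies in \<open>K\<close>, so its DNFs are among those
        compared.\<close>
      define c where "c = kappa T1 x"
      have c: "c \<in> K" using kappa_in_classes[OF T1] by (simp add: c_def)
      have "kappa T1 x = c \<longleftrightarrow> kappa T2 x = c"
        using qm_outputs_sound[OF step D(1)[OF c] x] qm_outputs_sound[OF step D(2)[OF c] x]
          same c by simp
      then show "kappa T1 x = kappa T2 x" by (simp add: c_def)
    qed
  next
    assume "predictive_equivalent m T1 T2"
    then have "?Q T1 c = ?Q T2 c" for c
      by (simp add: qm_outputs_def sorted_inputs_cong)
    then show "\<forall>c\<in>K. D1 c = D2 c"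
      using D qm_outputs_sorted_ex1[OF r step det] by metis
  qed
  have "\<exists>D. \<forall>c. D c \<in> ?Q T c" for T :: "'a dtree"
    using qm_outputs_sorted_ex1[OF r step det, of T] by (intro choice) blast
  then obtain D1 D2 where D: "\<And>c. D1 c \<in> ?Q T1 c" "\<And>c. D2 c \<in> ?Q T2 c" by metis
  show ?thesis
  proof
    assume "may_report K (sorted_inputs m r) step T1 T2 b"
    then show "b = predictive_equivalent m T1 T2"
      unfolding may_report_def using eq by blast
  next
    assume "b = predictive_equivalent m T1 T2"
    moreover have "(\<forall>c\<in>K. D1 c = D2 c) \<longleftrightarrow> predictive_equivalent m T1 T2"
      using eq D by blast
    ultimately show "may_report K (sorted_inputs m r) step T1 T2 b"
      unfolding may_report_def using D by blast
  qed
qed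

section \<open>Unsorted, nondeterministic runs\<close>

lemma qm_outputs_inputs_nonempty:
  fixes cost :: "conj_term set \<Rightarrow> 'c::linorder"
  shows "\<exists>S. S \<in> qm_outputs (inputs m) (min_cover m cost) T c"
proof -
  obtain ps where ps: "listing_of {t. prime_implicant m (class_pred T c) t} ps"
    using ex_listing[OF finite_prime_implicants] by blast
  obtain ms where ms: "listing_of {t. minterm m (class_pred T c) t} ms"
    using ex_listing[OF finite_minterms] by blast
  have "cover m ps ms (set ps)"
    using ps ms by (intro cover_prime_implicants) (auto simp: listing_of_def)
  then obtain S where "min_cover m cost ps ms S" using ex_min_cover by blast
  then show ?thesis using ps ms by (auto simp: qm_outputs_def inputs_def)
qed

definition nae :: "(nat \<Rightarrow> bool) \<Rightarrow> bool" where
  "nae x \<longleftrightarrow> \<not> (x 1 = x 2 \<and> x 2 = x 3)"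

text \<open>A conjunction despite its name; it detects a descent from 1 to 0 along the directed edge
  from \<open>i\<close> to \<open>j\<close>.\<close>

definition clause :: "nat \<Rightarrow> nat \<Rightarrow> conj_term" where
  "clause i j = {(i, True), (j, False)}"

lemma satisfies_clause [simp]: "satisfies x (clause i j) \<longleftrightarrow> x i \<and> \<not> x j"
  by (auto simp: satisfies_def clause_def)

lemma clause_eq_iff [simp]: "clause i j = clause k l \<longleftrightarrow> i = k \<and> j = l"
  by (auto simp: clause_def doubleton_eq_iff)

lemma card_clause [simp]: "card (clause i j) = 2"
  by (simp add: clause_def)

lemma range_3: "{1..3} = {1, 2, 3 :: nat}"
  by auto

lemma constant_in_feature_space: "(\<lambda>i\<in>{1..m}. b) \<in> feature_space m"
  by (auto simp: feature_space_def)

text \<open>A term without literals of polarity \<open>b\<close> holds at the constant point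
  \<open>\<not> b\<close>, where \<open>nae\<close> fails. So implicants contain both
  polarities.\<close>

lemma nae_implicant_literals:
  assumes "implicant 3 nae t"
  shows "\<exists>i\<in>{1..3}. (i, b) \<in> t"
proof (rule ccontr)
  assume no: "\<not> ?thesis"
  have "fst ` t \<subseteq> {1..3}" using assms by (simp add: implicant_def terms_def)
  then have "satisfies (\<lambda>i\<in>{1..3}. \<not> b) t"
    using no unfolding satisfies_def by force
  then have "nae (\<lambda>i\<in>{1..3}. \<not> b)"
    using assms constant_in_feature_space by (auto simp: implicant_def)
  then show False by (simp add: nae_def)
qed

lemma nae_implicant_card:
  assumes "implicant 3 nae t"
  shows "2 \<le> card t"
proof -
  obtain i j where "{(i, True), (j, False)} \<subseteq> t"
    using nae_implicant_literals[OF assms] by blast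
  moreover have "finite t" using assms finite_term by (auto simp: implicant_def)
  ultimately have "card {(i, True), (j, False)} \<le> card t" by (intro card_mono)
  then show ?thesis by simp
qed

lemma prime_implicant_clause:
  assumes "i \<in> {1..3}" "j \<in> {1..3}" "i \<noteq> j"
  shows "prime_implicant 3 nae (clause i j)"
proof -
  have "implicant 3 nae (clause i j)"
    using assms unfolding range_3
    by (auto simp: implicant_def nae_def) (auto simp: terms_def clause_def)
  \<comment> \<open>A clause has just one literal of each polarity, so dropping \<open>l\<close>
    loses the polarity \<open>snd l\<close>.\<close>
  moreover have "\<not> implicant 3 nae (clause i j - {l})" if "l \<in> clause i j" for l
    using that nae_implicant_literals[of "clause i j - {l}" "snd l"]
    by (auto simp: clause_def)
  ultimately show ?thesis by (simp add: prime_implicant_def)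
qed

text \<open>Three points of \<open>nae\<close>, no two satisfying a common implicant, force three
  terms, each with at least two literals.\<close>

lemma nae_cover_bounds:
  assumes ps: "set ps = {t. prime_implicant 3 nae t}" and ms: "set ms = {t. minterm 3 nae t}"
    and cover: "cover 3 ps ms S"
  shows "3 \<le> num_terms S" "6 \<le> num_literals S"
proof -
  have S: "finite S" "\<And>p. p \<in> S \<Longrightarrow> implicant 3 nae p"
    using cover ps
    by (auto simp: cover_def prime_implicant_def intro: finite_subset[of S "set ps"])
  \<comment> \<open>For \<open>i\<close> in \<open>{1..3}\<close> these are the unit points. They
    are pairwise separated because every implicant needs a positive literal.\<close>
  define e where "e i = (\<lambda>j\<in>{1..3 :: nat}. j = i)" for i :: nat
  have e: "e i \<in> feature_space 3" for i
    by (auto simp: e_def feature_space_def)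
  have "\<exists>p\<in>S. satisfies (e i) p" if "i \<in> {1..3}" for i
  proof -
    have "nae (e i)" using that unfolding range_3 by (auto simp: nae_def e_def)
    then have "minterm 3 nae (point_term 3 (e i))" using e by (intro minterm_point_term)
    then show ?thesis
      using cover ms e satisfies_point_term[of "e i" 3 "e i"]
      by (fastforce simp: cover_def term_entails_def)
  qed
  then obtain p where p: "\<And>i. i \<in> {1..3} \<Longrightarrow> p i \<in> S \<and> satisfies (e i) (p i)"
    by metis
  \<comment> \<open>The only positive literal an implicant satisfied by \<open>e i\<close> can have is \<open>(i, True)\<close>.\<close>
  have pos: "(i, True) \<in> p i" if i: "i \<in> {1..3}" for i
  proof -
    obtain j where "j \<in> {1..3}" "(j, True) \<in> p i"
      using nae_implicant_literals[OF S(2)] p[OF i] by blast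
    then show ?thesis using p[OF i] by (auto simp: satisfies_def e_def)
  qed
  have "inj_on p {1..3}"
  proof (rule inj_onI)
    fix i j assume ij: "i \<in> {1..3}" "j \<in> {1..3}" "p i = p j"
    then have "(i, True) \<in> p j" using pos by metis
    then show "i = j" using p[OF ij(2)] ij(1) by (auto simp: satisfies_def e_def)
  qed
  then have "card {1..3 :: nat} \<le> card S"
    using p S(1) by (intro card_inj_on_le[of p]) auto
  then show three: "3 \<le> num_terms S" by (simp add: num_terms_def)
  have "card S * 2 \<le> num_literals S"
    unfolding num_literals_def
    using sum_bounded_below[of S 2 card] S(2) nae_implicant_card by simp
  then show "6 \<le> num_literals S" using three by (simp add: num_terms_def)
qed

text \<open>A nonconstant Boolean labelling of a directed cycle has a descent in either orientation,
  so both triples cover. They attain the lower bounds 3 and 6.\<close>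

lemma min_cover_nae:
  assumes ps: "set ps = {t. prime_implicant 3 nae t}" and ms: "set ms = {t. minterm 3 nae t}"
    and cost: "cost \<in> {num_terms, num_literals}"
    and C: "C = {clause 1 2, clause 2 3, clause 3 1} \<or> C = {clause 2 1, clause 3 2, clause 1 3}"
  shows "min_cover 3 cost ps ms C"
proof -
  have sat: "\<exists>p\<in>C. satisfies x p" if "nae x" for x
    using that C unfolding nae_def by auto
  have "C \<subseteq> set ps" using C ps prime_implicant_clause by auto
  moreover have "\<exists>p\<in>C. term_entails 3 t p" if t: "minterm 3 nae t" for t
  proof -
    \<comment> \<open>Since a minterm holds at one point only, entailing \<open>p\<close> amounts to
      \<open>p\<close> holding there.\<close>
    obtain x where x: "x \<in> feature_space 3" "satisfies x t"
      and unique: "\<And>y. y \<in> feature_space 3 \<Longrightarrow> satisfies y t \<Longrightarrow> y = x"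
      using t unfolding minterm_def by blast
    have "nae x" using t x unfolding minterm_def implicant_def by blast
    then obtain p where "p \<in> C" "satisfies x p" using sat by blast
    then show ?thesis using unique unfolding term_entails_def by blast
  qed
  ultimately have "cover 3 ps ms C" using ms by (auto simp: cover_def)
  moreover have "num_terms C = 3" "num_literals C = 6"
    using C by (auto simp: num_terms_def num_literals_def)
  ultimately show ?thesis
    using nae_cover_bounds[OF ps ms] cost by (fastforce simp: min_cover_def is_arg_min_def)
qed

text \<open>The slot \<open>T\<close> is reached when \<open>x\<^sub>1 = 0\<close> and
  \<open>x\<^sub>2 = 1\<close>. There \<open>nae\<close> holds whatever \<open>x\<^sub>3\<close> is,
  so any subtree that always yields 1 fits.\<close>

definition nae_tree :: "nat dtree \<Rightarrow> nat dtree" where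
  "nae_tree T = Node 1 (Node 2 (Node 3 (Terminal 0) (Terminal 1)) T)
                       (Node 2 (Terminal 1) (Node 3 (Terminal 1) (Terminal 0)))"

lemma unsorted_may_be_incorrect:
  assumes cost: "cost \<in> {num_terms, num_literals}"
  shows "\<exists>(m :: nat) (K :: nat set) T1 T2.
        finite K \<and> T1 \<in> decision_trees m K \<and> T2 \<in> decision_trees m K \<and> T1 \<noteq> T2 \<and>
        predictive_equivalent m T1 T2 \<and>
        may_report K (inputs m) (min_cover m cost) T1 T2 False"
proof -
  \<comment> \<open>A redundant test of \<open>x\<^sub>3\<close> makes the trees distinct without
    changing the function.\<close>
  define T1 T2 where "T1 = nae_tree (Terminal 1)"
    and "T2 = nae_tree (Node 3 (Terminal 1) (Terminal 1))"
  have dt: "T1 \<in> decision_trees 3 {0, 1}" "T2 \<in> decision_trees 3 {0, 1}"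
    by (auto simp: T1_def T2_def nae_tree_def decision_trees_def terms_def)
  have nae: "class_pred T1 1 = nae" "class_pred T2 1 = nae"
    by (auto simp: fun_eq_iff class_pred_def nae_def T1_def T2_def nae_tree_def)
  obtain ps where ps: "listing_of {t. prime_implicant 3 nae t} ps"
    using ex_listing[OF finite_prime_implicants] by blast
  obtain ms where ms: "listing_of {t. minterm 3 nae t} ms"
    using ex_listing[OF finite_minterms] by blast
  have out: "C \<in> qm_outputs (inputs 3) (min_cover 3 cost) T 1"
    if "C = {clause 1 2, clause 2 3, clause 3 1} \<or> C = {clause 2 1, clause 3 2, clause 1 3}"
      "class_pred T 1 = nae" for C and T :: "nat dtree"
    using min_cover_nae[OF _ _ cost that(1), of ps ms] ps ms that(2)
    by (auto simp: qm_outputs_def inputs_def listing_of_def)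
  \<comment> \<open>A run needs outputs for class 0 too. Arbitrary admissible ones serve, and at
    class 1 they are overwritten by the two opposite cycles.\<close>
  define D where "D T c = (SOME S. S \<in> qm_outputs (inputs 3) (min_cover 3 cost) T c)"
    for T :: "nat dtree" and c
  have D: "D T c \<in> qm_outputs (inputs 3) (min_cover 3 cost) T c" for T c
    unfolding D_def by (rule someI_ex) (rule qm_outputs_inputs_nonempty)
  define D1 D2 where "D1 = (D T1)(1 := {clause 1 2, clause 2 3, clause 3 1})"
    and "D2 = (D T2)(1 := {clause 2 1, clause 3 2, clause 1 3})"
  have "D1 c \<in> qm_outputs (inputs 3) (min_cover 3 cost) T1 c"
    "D2 c \<in> qm_outputs (inputs 3) (min_cover 3 cost) T2 c" for c
    using D out[OF _ nae(1)] out[OF _ nae(2)] by (simp_all add: D1_def D2_def del: One_nat_def)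
  moreover have "clause 1 2 \<in> D1 1" "clause 1 2 \<notin> D2 1"
    by (simp_all add: D1_def D2_def)
  then have "D1 1 \<noteq> D2 1" by blast
  ultimately have "may_report {0, 1} (inputs 3) (min_cover 3 cost) T1 T2 False"
    unfolding may_report_def by blast
  moreover have "predictive_equivalent 3 T1 T2"
    by (simp add: predictive_equivalent_def T1_def T2_def nae_tree_def)
  moreover have "T1 \<noteq> T2" by (simp add: T1_def T2_def nae_tree_def)
  ultimately show ?thesis
    using dt by (intro exI[of _ 3] exI[of _ "{0, 1}"] exI[of _ T1] exI[of _ T2]) simp
qed

theorem proposition2:
  "(\<forall>cost \<in> {num_terms, num_literals}.
      \<exists>(m :: nat) (K :: nat set) T1 T2.
        finite K \<and> T1 \<in> decision_trees m K \<and> T2 \<in> decision_trees m K \<and> T1 \<noteq> T2 \<and>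
        predictive_equivalent m T1 T2 \<and>
        may_report K (inputs m) (min_cover m cost) T1 T2 False)
   \<and>
   (\<forall>(m :: nat) (K :: 'k set) (cost :: conj_term set \<Rightarrow> 'c::linorder) r step.
      finite K \<longrightarrow> linear_order_on (terms m) r \<longrightarrow>
      set_covering_step m cost step \<longrightarrow> deterministic step \<longrightarrow>
      (\<forall>T1 \<in> decision_trees m K. \<forall>T2 \<in> decision_trees m K. \<forall>b.
         may_report K (sorted_inputs m r) step T1 T2 b \<longleftrightarrow> b = predictive_equivalent m T1 T2))"
proof (rule conjI, goal_cases)
  case 1
  show ?case using unsorted_may_be_incorrect by (rule ballI)
next
  case 2
  show ?case
    by (intro allI impI ballI) (rule may_report_sorted_iff)
qed

end
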